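(* Let $(\gamma,\nu):I\to\Delta_1$ be a spacelike Legendre curve with curvature $(m,n)$ such that $\{t\in I:n(t)\ne0\}$ is dense in $I$. If $P^\pm(\gamma,\lambda_\pm)$ is a horocyclic parallel of $\gamma$, then $(P^\pm(\gamma,\lambda_\pm),\nu_P^\pm):I\to\Delta_1$ is a spacelike Legendre curve with curvature $$(m_P^\pm(t),n_P^\pm(t))=(\lambda_\pm(t)n(t)+m(t),\,n(t)),$$ where $\nu_P^\pm(t)=\lambda_\pm(t)\gamma(t)+\nu(t)\pm\lambda_\pm(t)\mu(t)$.
   Context: All maps are $C^\infty$; $I\subset\mathbb R$ is an interval; a dot denotes $d/dt$. In every formula with $\pm,\mp$ the upper signs are taken together and the lower signs together. $\mathbb R^3_1$ is $\mathbb R^3$ with $\langle x,y\rangle=-x_1y_1+x_2y_2+x_3y_3$ and $x\wedge y=(-(x_2y_3-x_3y_2),\,x_3y_1-x_1y_3,\,x_1y_2-x_2y_1)$. $H^2=\{x:\langle x,x\rangle=-1,\ x_1>0\}$, $S^2_1=\{x:\langle x,x\rangle=1\}$, $\Delta_1=\{(\nu_1,\nu_2)\in H^2\times S_1^2:\langle\nu_1,\nu_2\rangle=0\}$. A spacelike Legendre curve is a map $(\gamma,\nu):I\to\Delta_1$ with $\langle\dot\gamma,\nu\rangle=0$ on $I$; put $\mu=\gamma\wedge\nu$. Its curvature is the pair $(m,n)$ with $\dot\gamma=m\mu$, $\dot\nu=n\mu$ (then $\dot\mu=m\gamma-n\nu$). Horocyclic parallel: $P^\pm(\gamma,\lambda_\pm)=\gamma+\lambda_\pm\nu+\frac{\lambda_\pm^2}{2}(\gamma\pm\mu)$,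 where $\lambda_\pm:I\to\mathbb R$ is a solution of $\dot\lambda_\pm=\mp(\frac{\lambda_\pm^2n}{2}+\lambda_\pm m)$. *)

theory Defs
  imports "HOL-Analysis.Analysis"
begin

text \<open>Lorentz--Minkowski 3-space: the underlying vector space is \<^typ>\<open>real ^ 3\<close>; the first
  coordinate is the timelike one.\<close>

definition mink_inner :: "real ^ 3 \<Rightarrow> real ^ 3 \<Rightarrow> real" where
  "mink_inner x y = - (x $ 1 * y $ 1) + x $ 2 * y $ 2 + x $ 3 * y $ 3"

definition mink_wedge :: "real ^ 3 \<Rightarrow> real ^ 3 \<Rightarrow> real ^ 3" where
  "mink_wedge x y = vector
     [- (x $ 2 * y $ 3 - x $ 3 * y $ 2),
      x $ 3 * y $ 1 - x $ 1 * y $ 3,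
      x $ 1 * y $ 2 - x $ 2 * y $ 1]"

definition hyperbolic_plane :: "(real ^ 3) set" where
  "hyperbolic_plane = {x. mink_inner x x = - 1 \<and> x $ 1 > 0}"

definition de_sitter :: "(real ^ 3) set" where
  "de_sitter = {x. mink_inner x x = 1}"

definition Delta1 :: "((real ^ 3) \<times> (real ^ 3)) set" where
  "Delta1 = {(v, w). v \<in> hyperbolic_plane \<and> w \<in> de_sitter \<and> mink_inner v w = 0}"

text \<open>Maps on an interval \<open>I\<close> are total functions on \<^typ>\<open>real\<close> of which only the values on \<open>I\<close>
  matter. Derivatives are taken within \<open>I\<close>, hence are one-sided at an end point belonging to
  \<open>I\<close>. They are unique when the interval is nondegenerate, which is therefore part of the
  definition of an interval here.\<close>

definition nondegenerate_interval :: "real set \<Rightarrow> bool" where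
  "nondegenerate_interval I \<longleftrightarrow> is_interval I \<and> interior I \<noteq> {}"

primrec Ck_on :: "nat \<Rightarrow> (real \<Rightarrow> 'a::real_normed_vector) \<Rightarrow> real set \<Rightarrow> bool" where
  "Ck_on 0 f I \<longleftrightarrow> continuous_on I f"
| "Ck_on (Suc k) f I \<longleftrightarrow>
     (\<exists>f'. (\<forall>t\<in>I. (f has_vector_derivative f' t) (at t within I)) \<and> Ck_on k f' I)"

definition smooth_map_on :: "(real \<Rightarrow> 'a::real_normed_vector) \<Rightarrow> real set \<Rightarrow> bool" where
  "smooth_map_on f I \<longleftrightarrow> (\<forall>k. Ck_on k f I)"

definition spacelike_Legendre_curve ::
  "real set \<Rightarrow> (real \<Rightarrow> real ^ 3) \<Rightarrow> (real \<Rightarrow> real ^ 3) \<Rightarrow> bool" where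
  "spacelike_Legendre_curve I \<gamma> \<nu> \<longleftrightarrow>
     smooth_map_on \<gamma> I \<and> smooth_map_on \<nu> I \<and>
     (\<forall>t\<in>I. (\<gamma> t, \<nu> t) \<in> Delta1) \<and>
     (\<forall>t\<in>I. mink_inner (vector_derivative \<gamma> (at t within I)) (\<nu> t) = 0)"

definition Legendre_mu :: "(real \<Rightarrow> real ^ 3) \<Rightarrow> (real \<Rightarrow> real ^ 3) \<Rightarrow> real \<Rightarrow> real ^ 3" where
  "Legendre_mu \<gamma> \<nu> t = mink_wedge (\<gamma> t) (\<nu> t)"

definition has_Legendre_curvature ::
  "real set \<Rightarrow> (real \<Rightarrow> real ^ 3) \<Rightarrow> (real \<Rightarrow> real ^ 3) \<Rightarrow>
   (real \<Rightarrow> real) \<Rightarrow> (real \<Rightarrow> real) \<Rightarrow> bool" where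
  "has_Legendre_curvature I \<gamma> \<nu> m n \<longleftrightarrow>
     smooth_map_on m I \<and> smooth_map_on n I \<and>
     (\<forall>t\<in>I. (\<gamma> has_vector_derivative m t *\<^sub>R Legendre_mu \<gamma> \<nu> t) (at t within I) \<and>
             (\<nu> has_vector_derivative n t *\<^sub>R Legendre_mu \<gamma> \<nu> t) (at t within I))"

text \<open>Below, the sign \<open>s = 1\<close> selects the upper signs and \<open>s = - 1\<close> the lower signs.\<close>

definition horocyclic_parameter ::
  "real \<Rightarrow> real set \<Rightarrow> (real \<Rightarrow> real) \<Rightarrow> (real \<Rightarrow> real) \<Rightarrow> (real \<Rightarrow> real) \<Rightarrow> bool" where
  "horocyclic_parameter s I m n l \<longleftrightarrow>
     smooth_map_on l I \<and>
     (\<forall>t\<in>I. (l has_real_derivative - s * ((l t)\<^sup>2 * n t / 2 + l t * m t)) (at t within I))"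

definition horocyclic_parallel ::
  "real \<Rightarrow> (real \<Rightarrow> real ^ 3) \<Rightarrow> (real \<Rightarrow> real ^ 3) \<Rightarrow> (real \<Rightarrow> real) \<Rightarrow> real \<Rightarrow> real ^ 3" where
  "horocyclic_parallel s \<gamma> \<nu> l t =
     \<gamma> t + l t *\<^sub>R \<nu> t + ((l t)\<^sup>2 / 2) *\<^sub>R (\<gamma> t + s *\<^sub>R Legendre_mu \<gamma> \<nu> t)"

definition horocyclic_parallel_normal ::
  "real \<Rightarrow> (real \<Rightarrow> real ^ 3) \<Rightarrow> (real \<Rightarrow> real ^ 3) \<Rightarrow> (real \<Rightarrow> real) \<Rightarrow> real \<Rightarrow> real ^ 3" where
  "horocyclic_parallel_normal s \<gamma> \<nu> l t =
     l t *\<^sub>R \<gamma> t + \<nu> t + (s * l t) *\<^sub>R Legendre_mu \<gamma> \<nu> t"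

end

theory Submission
  imports Defs
begin

text \<open>With \<open>\<mu> = \<gamma> \<and> \<nu>\<close> the triple \<open>\<gamma>, \<nu>, \<mu>\<close> is a Lorentz-orthonormal frame and
  \<open>\<mu>' = m \<gamma> - n \<nu>\<close>. Expanding in this frame, the wedge product of the parallel and its normal is
  \<open>- s (l\<^sup>2/2) \<gamma> - s l \<nu> + (1 - l\<^sup>2/2) \<mu>\<close>, and the differential equation for \<open>l\<close> says exactly that the
  derivatives of both curves are multiples of this vector. The parallel lies on the upper
  sheet because the first coordinates of the frame satisfy \<open>\<gamma>\<^sub>1\<^sup>2 = 1 + \<nu>\<^sub>1\<^sup>2 + \<mu>\<^sub>1\<^sup>2\<close>, to which
  Cauchy--Schwarz applies.\<close>

section \<open>Smooth maps under sums and bounded bilinear products\<close>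

lemma Ck_on_SucD: "Ck_on (Suc k) f I \<Longrightarrow> Ck_on k f I"
proof (induction k arbitrary: f)
  case 0
  then show ?case
    by (auto intro: has_vector_derivative_continuous simp: continuous_on_eq_continuous_within)
next
  case (Suc k)
  then obtain f' where "\<forall>t\<in>I. (f has_vector_derivative f' t) (at t within I)" "Ck_on (Suc k) f' I"
    by (metis Ck_on.simps(2))
  then show ?case using Suc.IH by auto
qed

lemma Ck_on_const: "Ck_on k (\<lambda>t. c) I"
proof (induction k arbitrary: c)
  case (Suc k)
  have "\<forall>t\<in>I. ((\<lambda>t. c) has_vector_derivative 0) (at t within I)" by simp
  then show ?case using Suc[of 0] by (subst Ck_on.simps(2), intro exI[of _ "\<lambda>t. 0"]) simp
qed simp

lemma Ck_on_add: "Ck_on k f I \<Longrightarrow> Ck_on k g I \<Longrightarrow> Ck_on k (\<lambda>t. f t + g t) I"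
proof (induction k arbitrary: f g)
  case (Suc k)
  obtain f' where f: "\<forall>t\<in>I. (f has_vector_derivative f' t) (at t within I)" "Ck_on k f' I"
    using Suc.prems(1) by auto
  obtain g' where g: "\<forall>t\<in>I. (g has_vector_derivative g' t) (at t within I)" "Ck_on k g' I"
    using Suc.prems(2) by auto
  show ?case
    using f g Suc.IH[OF f(2) g(2)]
    by (subst Ck_on.simps(2), intro exI[of _ "\<lambda>t. f' t + g' t"]) (auto intro: has_vector_derivative_add)
qed (auto intro: continuous_intros)

text \<open>The general bilinear form covers real multiplication, scalar multiplication and the
  wedge product at once.\<close>

lemma (in bounded_bilinear) Ck_on_prod:
  "Ck_on k f I \<Longrightarrow> Ck_on k g I \<Longrightarrow> Ck_on k (\<lambda>t. prod (f t) (g t)) I"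
proof (induction k arbitrary: f g)
  case 0
  then show ?case by (auto intro: continuous_on)
next
  case (Suc k)
  obtain f' where f: "\<forall>t\<in>I. (f has_vector_derivative f' t) (at t within I)" "Ck_on k f' I"
    using Suc.prems(1) by auto
  obtain g' where g: "\<forall>t\<in>I. (g has_vector_derivative g' t) (at t within I)" "Ck_on k g' I"
    using Suc.prems(2) by auto
  \<comment> \<open>Each Leibniz term pairs a derivative of order \<open>k\<close> with an
    undifferentiated factor of order \<open>Suc k\<close>, so the latter is first lowered by
    \<open>Ck_on_SucD\<close>.\<close>
  have "Ck_on k (\<lambda>t. prod (f t) (g' t) + prod (f' t) (g t)) I"
    using Suc.IH Suc.prems[THEN Ck_on_SucD] f(2) g(2) by (intro Ck_on_add)
  then show ?case
    using f(1) g(1)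
    by (subst Ck_on.simps(2), intro exI[of _ "\<lambda>t. prod (f t) (g' t) + prod (f' t) (g t)"])
      (auto intro: has_vector_derivative)
qed

lemma smooth_map_on_const: "smooth_map_on (\<lambda>t. c) I"
  by (simp add: smooth_map_on_def Ck_on_const)

lemma smooth_map_on_add:
  "smooth_map_on f I \<Longrightarrow> smooth_map_on g I \<Longrightarrow> smooth_map_on (\<lambda>t. f t + g t) I"
  by (simp add: smooth_map_on_def Ck_on_add)

lemma (in bounded_bilinear) smooth_map_on_prod:
  "smooth_map_on f I \<Longrightarrow> smooth_map_on g I \<Longrightarrow> smooth_map_on (\<lambda>t. prod (f t) (g t)) I"
  by (simp add: smooth_map_on_def Ck_on_prod)

lemmas smooth_map_on_mult = bounded_bilinear.smooth_map_on_prod[OF bounded_bilinear_mult]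
lemmas smooth_map_on_scaleR = bounded_bilinear.smooth_map_on_prod[OF bounded_bilinear_scaleR]

section \<open>Minkowski inner and wedge products\<close>

lemma bounded_bilinear_mink_wedge: "bounded_bilinear mink_wedge"
  unfolding bilinear_conv_bounded_bilinear[symmetric] bilinear_def linear_iff
  by (auto simp: mink_wedge_def vec_eq_iff forall_3 algebra_simps)

lemma bounded_bilinear_mink_inner: "bounded_bilinear mink_inner"
  unfolding bilinear_conv_bounded_bilinear[symmetric] bilinear_def linear_iff
  by (auto simp: mink_inner_def algebra_simps)

interpretation wedge: bounded_bilinear mink_wedge
  by (rule bounded_bilinear_mink_wedge)

interpretation mink: bounded_bilinear mink_inner
  by (rule bounded_bilinear_mink_inner)

lemma mink_inner_commute: "mink_inner x y = mink_inner y x"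
  by (simp add: mink_inner_def mult.commute)

lemma mink_wedge_anticommute: "mink_wedge y x = - mink_wedge x y"
  by (simp add: mink_wedge_def vec_eq_iff forall_3)

lemma mink_wedge_self: "mink_wedge x x = 0"
  by (simp add: mink_wedge_def vec_eq_iff forall_3)

text \<open>The Lorentzian form of the double cross product rule; its sign is opposite to the
  Euclidean one. It yields the multiplication table of the frame.\<close>

lemma mink_wedge_triple:
  "mink_wedge x (mink_wedge y z) = mink_inner x y *\<^sub>R z - mink_inner x z *\<^sub>R y"
  by (simp add: mink_wedge_def mink_inner_def vec_eq_iff forall_3 algebra_simps)

lemma mink_inner_wedge_left: "mink_inner x (mink_wedge x y) = 0"
  by (simp add: mink_wedge_def mink_inner_def algebra_simps)

lemma mink_inner_wedge_right: "mink_inner y (mink_wedge x y) = 0"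
  by (simp add: mink_wedge_def mink_inner_def algebra_simps)

lemma mink_inner_wedge_wedge:
  "mink_inner (mink_wedge x y) (mink_wedge x y) = (mink_inner x y)\<^sup>2 - mink_inner x x * mink_inner y y"
  by (simp add: mink_wedge_def mink_inner_def power2_eq_square algebra_simps)

text \<open>This is Lagrange's identity in the plane of the last two coordinates: adding the product
  of the first coordinates to \<open>mink_inner\<close> leaves the Euclidean product of the spatial
  parts.\<close>

lemma mink_wedge_first_sq:
  "(mink_wedge x y $ 1)\<^sup>2 =
    (mink_inner x x + (x $ 1)\<^sup>2) * (mink_inner y y + (y $ 1)\<^sup>2) - (mink_inner x y + x $ 1 * y $ 1)\<^sup>2"
  by (simp add: mink_wedge_def mink_inner_def power2_eq_square algebra_simps)

section \<open>Frame algebra at one point of \<open>Delta1\<close>, with \<open>u\<close> as the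
  value of \<mu>\<close>

context
  fixes v w :: "real ^ 3" and u
  assumes vw: "(v, w) \<in> Delta1"
  defines "u \<equiv> mink_wedge v w"
begin

lemma Delta1_inner:
  "mink_inner v v = - 1" "mink_inner w w = 1" "mink_inner u u = 1"
  "mink_inner v w = 0" "mink_inner w v = 0" "mink_inner v u = 0" "mink_inner u v = 0"
  "mink_inner w u = 0" "mink_inner u w = 0"
  using vw
  by (auto simp: u_def Delta1_def hyperbolic_plane_def de_sitter_def mink_inner_wedge_left
      mink_inner_wedge_right mink_inner_wedge_wedge mink_inner_commute[of w v]
      mink_inner_commute[of "mink_wedge v w"])

lemma Delta1_wedge:
  "mink_wedge w v = - u" "mink_wedge v u = - w" "mink_wedge u v = w"
  "mink_wedge w u = - v" "mink_wedge u w = v"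
  using Delta1_inner
  by (auto simp: u_def mink_wedge_anticommute[of w v] mink_wedge_anticommute[of "mink_wedge v w"]
      mink_wedge_triple)

text \<open>Geometrically, the Minkowski square -1 of the first basis vector, computed in the
  frame.\<close>

lemma Delta1_first_sq: "(v $ 1)\<^sup>2 = 1 + (w $ 1)\<^sup>2 + (u $ 1)\<^sup>2"
  unfolding u_def mink_wedge_first_sq Delta1_inner by (simp add: power2_eq_square algebra_simps)

text \<open>Orthonormality turns the first assumption into the equation of the hyperboloid. What
  remains is the sign of the first coordinate: \<open>c * v $ 1\<close> must dominate the two
  spacelike contributions.\<close>

lemma hyperbolic_plane_combination:
  assumes "c\<^sup>2 = 1 + a\<^sup>2 + b\<^sup>2" and "c > 0"
  shows "c *\<^sub>R v + a *\<^sub>R w + b *\<^sub>R u \<in> hyperbolic_plane"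
proof -
  have "\<bar>a * w $ 1 + b * u $ 1\<bar> < c * v $ 1"
  proof (rule power2_less_imp_less)
    have "(a * w $ 1 + b * u $ 1)\<^sup>2 = (a\<^sup>2 + b\<^sup>2) * ((w $ 1)\<^sup>2 + (u $ 1)\<^sup>2) - (a * u $ 1 - b * w $ 1)\<^sup>2"
      by (simp add: power2_eq_square algebra_simps)
    \<comment> \<open>Once distributed, the mixed products cancel and only nonnegative squares and
      the constant 1 remain; the 1 makes the inequality strict.\<close>
    also have "\<dots> < (1 + (a\<^sup>2 + b\<^sup>2)) * (1 + ((w $ 1)\<^sup>2 + (u $ 1)\<^sup>2))"
      unfolding distrib_left distrib_right
      using zero_le_power2[of "a * u $ 1 - b * w $ 1"] zero_le_power2[of a] zero_le_power2[of b]
        zero_le_power2[of "w $ 1"] zero_le_power2[of "u $ 1"] by linarith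
    also have "\<dots> = (c * v $ 1)\<^sup>2"
      by (simp add: power_mult_distrib assms(1) Delta1_first_sq add.assoc)
    finally show "\<bar>a * w $ 1 + b * u $ 1\<bar>\<^sup>2 < (c * v $ 1)\<^sup>2" by simp
    show "0 \<le> c * v $ 1" using vw assms(2) by (simp add: Delta1_def hyperbolic_plane_def)
  qed
  moreover have "mink_inner (c *\<^sub>R v + a *\<^sub>R w + b *\<^sub>R u) (c *\<^sub>R v + a *\<^sub>R w + b *\<^sub>R u) = - 1"
    using assms(1)
    by (simp add: mink.add_left mink.add_right mink.scaleR_left mink.scaleR_right Delta1_inner
        power2_eq_square)
  ultimately show ?thesis by (simp add: hyperbolic_plane_def)
qed

context
  fixes s l :: real
  assumes s: "s = 1 \<or> s = - 1"
begin

text \<open>The pair is the image of \<open>(v, w)\<close> under the null rotation that fixes the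
  lightlike vector \<open>v + s *\<^sub>R u\<close>. In frame coordinates the hyperboloid equation
  reduces to \<open>s\<^sup>2 = 1\<close>.\<close>

lemma parallel_frame_Delta1:
  "(v + l *\<^sub>R w + (l\<^sup>2 / 2) *\<^sub>R (v + s *\<^sub>R u), l *\<^sub>R v + w + (s * l) *\<^sub>R u) \<in> Delta1"
proof -
  have "(1 + l\<^sup>2 / 2)\<^sup>2 = 1 + l\<^sup>2 + (l\<^sup>2 / 2 * s)\<^sup>2"
    using s by (auto simp: power2_eq_square field_simps)
  moreover have "1 + l\<^sup>2 / 2 > 0"
    by (simp add: add_pos_nonneg)
  ultimately have "(1 + l\<^sup>2 / 2) *\<^sub>R v + l *\<^sub>R w + (l\<^sup>2 / 2 * s) *\<^sub>R u \<in> hyperbolic_plane"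
    by (rule hyperbolic_plane_combination)
  moreover have "(1 + l\<^sup>2 / 2) *\<^sub>R v + l *\<^sub>R w + (l\<^sup>2 / 2 * s) *\<^sub>R u
      = v + l *\<^sub>R w + (l\<^sup>2 / 2) *\<^sub>R (v + s *\<^sub>R u)"
    by (simp add: algebra_simps)
  ultimately show ?thesis
    using s by (auto simp: Delta1_def de_sitter_def mink.add_left mink.add_right mink.scaleR_left
        mink.scaleR_right Delta1_inner power2_eq_square algebra_simps)
qed

text \<open>The third vector of the rotated frame: adding \<open>s\<close> times it to the new first
  vector gives back \<open>v + s *\<^sub>R u\<close>.\<close>

lemma parallel_frame_wedge:
  "mink_wedge (v + l *\<^sub>R w + (l\<^sup>2 / 2) *\<^sub>R (v + s *\<^sub>R u)) (l *\<^sub>R v + w + (s * l) *\<^sub>R u)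
    = (- s * (l\<^sup>2 / 2)) *\<^sub>R v - (s * l) *\<^sub>R w + (1 - l\<^sup>2 / 2) *\<^sub>R u"
  \<comment> \<open>The first simplification expands bilinearly; the flipped \<open>u_def\<close>
    supplies the table entry for \<open>mink_wedge v w\<close>, which \<open>Delta1_wedge\<close>
    does not list. The second compares coordinates.\<close>
  by (use s in \<open>elim disjE\<close>)
    (simp_all add: wedge.add_left wedge.add_right wedge.diff_left wedge.diff_right wedge.minus_left
      wedge.minus_right wedge.scaleR_left wedge.scaleR_right Delta1_wedge mink_wedge_self flip: u_def, simp_all add: vec_eq_iff forall_3 power2_eq_square field_simps)

end

end

section \<open>From points to curves\<close>

lemma nondegenerate_interval_at_within:
  assumes "nondegenerate_interval I" "t \<in> I"
  shows "at t within I \<noteq> bot"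
proof -
  have "I \<noteq> {t}" using assms(1) by (auto simp: nondegenerate_interval_def)
  then have "t islimpt I"
    using assms by (intro connected_imp_perfect)
      (auto simp: nondegenerate_interval_def is_interval_connected_1)
  then show ?thesis by (simp add: trivial_limit_within)
qed

text \<open>Orthogonality to \<nu> follows from the curvature equation, since the derivative of
  \<gamma> is a multiple of a wedge product with \<nu>. Nondegeneracy identifies
  \<open>vector_derivative\<close> with that multiple.\<close>

lemma spacelike_Legendre_curveI:
  assumes I: "nondegenerate_interval I"
    and "smooth_map_on \<gamma> I" "smooth_map_on \<nu> I" "\<And>t. t \<in> I \<Longrightarrow> (\<gamma> t, \<nu> t) \<in> Delta1"
    and curv: "has_Legendre_curvature I \<gamma> \<nu> m n"
  shows "spacelike_Legendre_curve I \<gamma> \<nu>"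
proof -
  have "mink_inner (vector_derivative \<gamma> (at t within I)) (\<nu> t) = 0" if t: "t \<in> I" for t
  proof -
    have "vector_derivative \<gamma> (at t within I) = m t *\<^sub>R Legendre_mu \<gamma> \<nu> t"
      using curv t nondegenerate_interval_at_within[OF I t]
      by (auto simp: has_Legendre_curvature_def intro: vector_derivative_within)
    then show ?thesis
      by (simp add: mink.scaleR_left Legendre_mu_def mink_inner_commute[of _ "\<nu> t"]
          mink.scaleR_right mink_inner_wedge_right)
  qed
  then show ?thesis using assms by (simp add: spacelike_Legendre_curve_def)
qed

theorem proposition3p13:
  fixes I :: "real set" and \<gamma> \<nu> :: "real \<Rightarrow> real ^ 3" and m n l :: "real \<Rightarrow> real" and s :: real
  assumes "nondegenerate_interval I"
    and "spacelike_Legendre_curve I \<gamma> \<nu>"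
    and "has_Legendre_curvature I \<gamma> \<nu> m n"
    and "I \<subseteq> closure {t \<in> I. n t \<noteq> 0}"
    and "s = 1 \<or> s = - 1"
    and "horocyclic_parameter s I m n l"
  shows "spacelike_Legendre_curve I (horocyclic_parallel s \<gamma> \<nu> l) (horocyclic_parallel_normal s \<gamma> \<nu> l)
    \<and> has_Legendre_curvature I (horocyclic_parallel s \<gamma> \<nu> l) (horocyclic_parallel_normal s \<gamma> \<nu> l)
        (\<lambda>t. l t * n t + m t) n"
proof -
  let ?\<mu> = "Legendre_mu \<gamma> \<nu>"
  let ?P = "horocyclic_parallel s \<gamma> \<nu> l" and ?N = "horocyclic_parallel_normal s \<gamma> \<nu> l"
  have smooth: "smooth_map_on \<gamma> I" "smooth_map_on \<nu> I" "smooth_map_on m I" "smooth_map_on n I"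
      "smooth_map_on l I"
    and D: "\<And>t. t \<in> I \<Longrightarrow> (\<gamma> t, \<nu> t) \<in> Delta1"
    and d\<gamma>: "\<And>t. t \<in> I \<Longrightarrow> (\<gamma> has_vector_derivative m t *\<^sub>R ?\<mu> t) (at t within I)"
    and d\<nu>: "\<And>t. t \<in> I \<Longrightarrow> (\<nu> has_vector_derivative n t *\<^sub>R ?\<mu> t) (at t within I)"
    and dl: "\<And>t. t \<in> I \<Longrightarrow>
      (l has_real_derivative - s * ((l t)\<^sup>2 * n t / 2 + l t * m t)) (at t within I)"
    using assms
    by (auto simp: spacelike_Legendre_curve_def has_Legendre_curvature_def horocyclic_parameter_def)
  have smooth_\<mu>: "smooth_map_on ?\<mu> I"
    unfolding Legendre_mu_def[abs_def] by (intro wedge.smooth_map_on_prod smooth)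
  \<comment> \<open>By Leibniz, the factor \<nu>' contributes \<open>n\<close> times \<gamma> \<and>
    \<mu> = -\<nu>, and \<gamma>' contributes \<open>m\<close> times \<mu> \<and> \<nu> =
    \<gamma>.\<close>
  have d\<mu>: "(?\<mu> has_vector_derivative m t *\<^sub>R \<gamma> t - n t *\<^sub>R \<nu> t) (at t within I)" if t: "t \<in> I" for t
    using wedge.has_vector_derivative[OF d\<gamma>[OF t] d\<nu>[OF t]]
    by (simp add: Legendre_mu_def[abs_def] wedge.scaleR_left wedge.scaleR_right
        Delta1_wedge[OF D[OF t]])
  have smooth_P: "smooth_map_on ?P I"
    \<comment> \<open>Squares and quotients become products, to which the closure rules
      apply.\<close>
    unfolding horocyclic_parallel_def[abs_def] power2_eq_square divide_inverse
    by (intro smooth_map_on_add smooth_map_on_scaleR smooth_map_on_mult smooth_map_on_const smooth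
        smooth_\<mu>)
  have smooth_N: "smooth_map_on ?N I"
    unfolding horocyclic_parallel_normal_def[abs_def]
    by (intro smooth_map_on_add smooth_map_on_scaleR smooth_map_on_mult smooth_map_on_const smooth
        smooth_\<mu>)
  have \<mu>P: "Legendre_mu ?P ?N t = (- s * ((l t)\<^sup>2 / 2)) *\<^sub>R \<gamma> t - (s * l t) *\<^sub>R \<nu> t
      + (1 - (l t)\<^sup>2 / 2) *\<^sub>R ?\<mu> t" if t: "t \<in> I" for t
    unfolding Legendre_mu_def horocyclic_parallel_def horocyclic_parallel_normal_def
    by (rule parallel_frame_wedge[OF D[OF t] assms(5)])
  have dP: "(?P has_vector_derivative (l t * n t + m t) *\<^sub>R Legendre_mu ?P ?N t) (at t within I)"
    if t: "t \<in> I" for t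
  proof -
    let ?l' = "- s * ((l t)\<^sup>2 * n t / 2 + l t * m t)"
    let ?\<mu>' = "m t *\<^sub>R \<gamma> t - n t *\<^sub>R \<nu> t"
    have dl2: "((\<lambda>t. (l t)\<^sup>2 / 2) has_real_derivative l t * ?l') (at t within I)"
      by (rule derivative_eq_intros dl[OF t] refl | simp)+
    \<comment> \<open>The expression keeps the raw shape produced by the sum and product rules; the
      term with factor 0 is the derivative of the constant \<open>s\<close>.\<close>
    have "(?P has_vector_derivative
        m t *\<^sub>R ?\<mu> t + (l t *\<^sub>R n t *\<^sub>R ?\<mu> t + ?l' *\<^sub>R \<nu> t)
        + (((l t)\<^sup>2 / 2) *\<^sub>R (m t *\<^sub>R ?\<mu> t + (s *\<^sub>R ?\<mu>' + 0 *\<^sub>R ?\<mu> t))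
          + (l t * ?l') *\<^sub>R (\<gamma> t + s *\<^sub>R ?\<mu> t))) (at t within I)"
      unfolding horocyclic_parallel_def[abs_def]
      by (intro has_vector_derivative_add has_vector_derivative_scaleR DERIV_const d\<gamma>[OF t] d\<nu>[OF t]
          d\<mu>[OF t] dl[OF t] dl2)
    \<comment> \<open>With the equation for \<open>l\<close> inserted, every coefficient acquires
      the factor \<open>l n + m\<close>; that of \<nu>, for instance, is l' - s n l^2/2 = -s l (l n
      + m).\<close>
    moreover have "m t *\<^sub>R ?\<mu> t + (l t *\<^sub>R n t *\<^sub>R ?\<mu> t + ?l' *\<^sub>R \<nu> t)
        + (((l t)\<^sup>2 / 2) *\<^sub>R (m t *\<^sub>R ?\<mu> t + (s *\<^sub>R ?\<mu>' + 0 *\<^sub>R ?\<mu> t))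
          + (l t * ?l') *\<^sub>R (\<gamma> t + s *\<^sub>R ?\<mu> t))
        = (l t * n t + m t) *\<^sub>R Legendre_mu ?P ?N t"
      unfolding \<mu>P[OF t] using assms(5)
      by (elim disjE) (simp_all add: vec_eq_iff forall_3 power2_eq_square field_simps)
    ultimately show ?thesis by (simp only:)
  qed
  have dN: "(?N has_vector_derivative n t *\<^sub>R Legendre_mu ?P ?N t) (at t within I)"
    if t: "t \<in> I" for t
  proof -
    let ?l' = "- s * ((l t)\<^sup>2 * n t / 2 + l t * m t)"
    let ?\<mu>' = "m t *\<^sub>R \<gamma> t - n t *\<^sub>R \<nu> t"
    have "(?N has_vector_derivative
        (l t *\<^sub>R m t *\<^sub>R ?\<mu> t + ?l' *\<^sub>R \<gamma> t) + n t *\<^sub>R ?\<mu> t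
        + ((s * l t) *\<^sub>R ?\<mu>' + (s * ?l') *\<^sub>R ?\<mu> t)) (at t within I)"
      unfolding horocyclic_parallel_normal_def[abs_def]
      by (intro has_vector_derivative_add has_vector_derivative_scaleR DERIV_cmult d\<gamma>[OF t] d\<nu>[OF t]
          d\<mu>[OF t] dl[OF t])
    \<comment> \<open>Here the terms in \<open>m\<close> cancel: the coefficient of \<gamma> is l' +
      s l m = -s n l^2/2. Hence the second curvature stays \<open>n\<close>.\<close>
    moreover have "(l t *\<^sub>R m t *\<^sub>R ?\<mu> t + ?l' *\<^sub>R \<gamma> t) + n t *\<^sub>R ?\<mu> t
        + ((s * l t) *\<^sub>R ?\<mu>' + (s * ?l') *\<^sub>R ?\<mu> t)
        = n t *\<^sub>R Legendre_mu ?P ?N t"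
      unfolding \<mu>P[OF t] using assms(5)
      by (elim disjE) (simp_all add: vec_eq_iff forall_3 power2_eq_square field_simps)
    ultimately show ?thesis by (simp only:)
  qed
  have curv: "has_Legendre_curvature I ?P ?N (\<lambda>t. l t * n t + m t) n"
    unfolding has_Legendre_curvature_def
    using smooth dP dN by (auto intro: smooth_map_on_add smooth_map_on_mult)
  moreover have "(?P t, ?N t) \<in> Delta1" if t: "t \<in> I" for t
    unfolding horocyclic_parallel_def horocyclic_parallel_normal_def Legendre_mu_def
    by (rule parallel_frame_Delta1[OF D[OF t] assms(5)])
  ultimately show ?thesis
    using spacelike_Legendre_curveI[OF assms(1) smooth_P smooth_N] by blast
qed

end
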